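(* Let $q,\alpha,z$ be nonzero complex numbers with $|q|<1$, $|zq|<1$ and $|zq/\alpha|<1$, and put $a=zq$, $b=-zq/\alpha$, $c=z^2q^2/\alpha$. Then the identity $$F(\alpha,z;q)=F\left(\frac{1}{\alpha},-\frac{z}{\alpha};q\right)$$ is equivalent to the identity $$\rho_{3}(a,b,c;q^2)-\rho_{3}(b,a,c;q^2)=\left(\frac1b-\frac1a\right)\frac{(c,\,aq^2/b,\,bq^2/a,\,q^2;q^2)_{\infty}}{(-c/a,\,-c/b,\,-aq^2,\,-bq^2;q^2)_{\infty}}.$$
   Context: Notation: $(a;q)_n=\prod_{m=0}^{n-1}(1-aq^m)$, $(a;q)_0=1$, $(a;q)_\infty=\prod_{m=0}^{\infty}(1-aq^m)$ for $|q|<1$, and $(a_1,\dots,a_m;q)_\infty=(a_1;q)_\infty\cdots(a_m;q)_\infty$. Definitions: $$F(\alpha,z;q)=\frac{1}{(-zq^2/\alpha;q^2)_\infty(zq^2;q^2)_\infty}\Bigg(\frac{q^2}{1+zq/\alpha}\sum_{m=0}^{\infty}\frac{(-\alpha/(zq);q^2)_{m+1}}{(-zq;q^2)_{m+1}}(zq)^m-\frac{\alpha q}{z}\,\frac{(z^2q^2/\alpha;q^2)_\infty}{(z^2q^2;q^4)_{\infty}(z^2q^2/\alpha^2;q^{4})_{\infty}}\sum_{n=0}^{\infty}\alpha^nq^{n^2+n}\Bigg),$$ $$\rho_{3}(a,b,c;q)=\left(1+\frac{1}{b}\right)\sum_{n=0}^{\infty}\frac{(c;q)_n(-1)^nq^{n(n+1)/2}a^nb^{-n}}{(-aq;q)_{n}(-c/b;q)_{n+1}}.$$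 The second identity in the claim is the case of base $q^2$ and these $a,b,c$ of Kang's three-variable reciprocity theorem, which is stated for $|c|<|a|<1$ and $|c|<|b|<1$: $$\rho_{3}(a,b,c;q)-\rho_{3}(b,a,c;q)=\left(\frac{1}{b}-\frac{1}{a}\right)\frac{(c,aq/b,bq/a,q;q)_{\infty}}{(-c/a,-c/b,-aq,-bq;q)_{\infty}}.$$ *)

theory Defs
  imports "HOL-Analysis.Analysis"
begin

definition qpoch :: "complex \<Rightarrow> complex \<Rightarrow> nat \<Rightarrow> complex" where
  "qpoch a q n = (\<Prod>m<n. 1 - a * q ^ m)"

text \<open>Meant for \<open>norm q < 1\<close>, where the product converges; it is \<open>0\<close> if one of its factors is.\<close>

definition qpoch_inf :: "complex \<Rightarrow> complex \<Rightarrow> complex" where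
  "qpoch_inf a q = (\<Prod>m. 1 - a * q ^ m)"

definition qpochs_inf :: "complex list \<Rightarrow> complex \<Rightarrow> complex" where
  "qpochs_inf as q = (\<Prod>a\<leftarrow>as. qpoch_inf a q)"

definition F :: "complex \<Rightarrow> complex \<Rightarrow> complex \<Rightarrow> complex" where
  "F \<alpha> z q =
     1 / (qpoch_inf (- (z * q\<^sup>2 / \<alpha>)) (q\<^sup>2) * qpoch_inf (z * q\<^sup>2) (q\<^sup>2)) *
     (q\<^sup>2 / (1 + z * q / \<alpha>) *
        (\<Sum>m. qpoch (- (\<alpha> / (z * q))) (q\<^sup>2) (m + 1) / qpoch (- (z * q)) (q\<^sup>2) (m + 1) * (z * q) ^ m)
      - \<alpha> * q / z *
        (qpoch_inf (z\<^sup>2 * q\<^sup>2 / \<alpha>) (q\<^sup>2) /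
          (qpoch_inf (z\<^sup>2 * q\<^sup>2) (q ^ 4) * qpoch_inf (z\<^sup>2 * q\<^sup>2 / \<alpha>\<^sup>2) (q ^ 4))) *
        (\<Sum>n. \<alpha> ^ n * q ^ (n\<^sup>2 + n)))"

definition rho3 :: "complex \<Rightarrow> complex \<Rightarrow> complex \<Rightarrow> complex \<Rightarrow> complex" where
  "rho3 a b c q =
     (1 + 1 / b) *
     (\<Sum>n. qpoch c q n * (-1) ^ n * q ^ (n * (n + 1) div 2) * a ^ n * b powi (- int n) /
           (qpoch (- (a * q)) q n * qpoch (- (c / b)) q (n + 1)))"

end

theory Submission
  imports Defs "HOL-Library.Nat_Bijection"
begin

text \<open>
  Write \<open>p = q\<^sup>2\<close>. Then \<open>\<alpha> = - a / b\<close>, \<open>z = a / q\<close> and \<open>c = - a b\<close>, and replacing \<open>(\<alpha>, z)\<close> by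
  \<open>(1 / \<alpha>, - z / \<alpha>)\<close> amounts to exchanging \<open>a\<close> and \<open>b\<close> while \<open>c\<close> is kept. So both identities
  compare a function of \<open>(a, b)\<close> with the same function of \<open>(b, a)\<close>, and two classical facts match
  them up.

  The first series in \<open>F\<close> is, up to elementary factors, the Rogers--Fine series
  \<open>\<Sum>m. (p / b; p)\<^sub>m / (- a p; p)\<^sub>m a ^ m\<close>. A Heine-type transformation (\<open>rogers_fine_sums\<close>) turns this
  into the series of \<open>\<rho>\<^sub>3(a, b, - a b; p)\<close>, which gives (\<open>F_eq_rho3\<close>)
  \<open>F \<alpha> z q = P (W \<theta>(\<alpha>) / b - \<rho>\<^sub>3(a, b, c; p) / ((1 + a) (1 + b)))\<close>
  with \<open>P \<noteq> 0\<close> and \<open>W\<close> symmetric in \<open>a\<close> and \<open>b\<close>, and with the partial theta series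
  \<open>\<theta>(x) = \<Sum>n\<ge>0. x ^ n p ^ (n (n + 1) / 2)\<close>.

  Hence the symmetry of \<open>F\<close> says that the difference of the two \<open>\<rho>\<^sub>3\<close> values equals
  \<open>(1 + a) (1 + b) W (\<theta>(\<alpha>) / b - \<theta>(1 / \<alpha>) / a)\<close>. Since \<open>a = - \<alpha> b\<close>, the last factor is
  \<open>(\<theta>(\<alpha>) + \<theta>(1 / \<alpha>) / \<alpha>) / b\<close>: the two partial theta series are the nonnegative and the negative
  half of the full theta series \<open>\<Sum>n\<in>\<int>. \<alpha> ^ n p ^ (n (n + 1) / 2)\<close>. The Jacobi triple product
  (\<open>jacobi_triple_product\<close>) evaluates it, and the result is the product in the reciprocity theorem.
\<close>

section \<open>The $q$-shifted factorial\<close>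

lemma qpoch_0 [simp]: "qpoch a p 0 = 1"
  by (simp add: qpoch_def)

lemma qpoch_Suc: "qpoch a p (Suc n) = qpoch a p n * (1 - a * p ^ n)"
  by (simp add: qpoch_def)

lemma qpoch_add: "qpoch a p (m + n) = qpoch a p m * qpoch (a * p ^ m) p n"
  by (induction n) (simp_all add: qpoch_Suc power_add mult.assoc)

lemma qpoch_Suc_shift: "qpoch a p (Suc n) = (1 - a) * qpoch (a * p) p n"
  using qpoch_add[of a p 1 n] by (simp add: qpoch_Suc)

lemma qpoch_nonzero: "(\<And>n. a * p ^ n \<noteq> 1) \<Longrightarrow> qpoch a p n \<noteq> 0"
  by (auto simp: qpoch_def)

lemma mult_power_neq_1:
  fixes a p :: complex
  assumes "norm a < 1" "norm p < 1"
  shows "a * p ^ n \<noteq> 1"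
proof
  assume *: "a * p ^ n = 1"
  have "norm (a * p ^ n) \<le> norm a * 1"
    unfolding norm_mult norm_power using assms by (intro mult_left_mono power_le_one) auto
  with * assms show False by simp
qed

lemma convergent_prod_qpoch:
  fixes a p :: complex
  assumes "norm p < 1"
  shows "convergent_prod (\<lambda>m. 1 - a * p ^ m)"
proof (intro abs_convergent_prod_imp_convergent_prod summable_imp_abs_convergent_prod)
  have "summable (\<lambda>m. norm a * norm p ^ m)"
    using assms by (intro summable_mult summable_geometric) auto
  thus "summable (\<lambda>m. norm (1 - a * p ^ m - 1))"
    by (simp add: norm_mult norm_power)
qed

lemma qpoch_tendsto:
  assumes "norm p < 1"
  shows "qpoch a p \<longlonglongrightarrow> qpoch_inf a p"
  using convergent_prod_LIMSEQ[OF convergent_prod_qpoch[OF assms, of a]]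
  by (simp add: LIMSEQ_lessThan_iff_atMost[symmetric] qpoch_def[abs_def] qpoch_inf_def)

lemma qpoch_inf_nonzero:
  assumes "norm p < 1" "\<And>n. a * p ^ n \<noteq> 1"
  shows "qpoch_inf a p \<noteq> 0"
  unfolding qpoch_inf_def
  using assms by (intro prodinf_nonzero convergent_prod_qpoch) (metis eq_iff_diff_eq_0)+

text \<open>
  Comparing limits of the finite products covers the case where a factor vanishes, in which an
  infinite product cannot be split by dividing.
\<close>

lemma qpoch_inf_split_head:
  assumes "norm p < 1"
  shows "qpoch_inf a p = (1 - a) * qpoch_inf (a * p) p"
proof (rule LIMSEQ_unique)
  show "(\<lambda>n. qpoch a p (Suc n)) \<longlonglongrightarrow> qpoch_inf a p"
    using qpoch_tendsto[OF assms] by (rule LIMSEQ_Suc)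
  show "(\<lambda>n. qpoch a p (Suc n)) \<longlonglongrightarrow> (1 - a) * qpoch_inf (a * p) p"
    unfolding qpoch_Suc_shift by (intro tendsto_intros qpoch_tendsto assms)
qed

lemma qpoch_inf_square:
  assumes "norm p < 1"
  shows "qpoch_inf (a\<^sup>2) (p\<^sup>2) = qpoch_inf a p * qpoch_inf (- a) p"
proof (rule LIMSEQ_unique)
  have "norm (p\<^sup>2) < 1"
    using assms by (simp add: norm_power power_less_one_iff)
  thus "qpoch (a\<^sup>2) (p\<^sup>2) \<longlonglongrightarrow> qpoch_inf (a\<^sup>2) (p\<^sup>2)"
    by (rule qpoch_tendsto)
  have "qpoch (a\<^sup>2) (p\<^sup>2) = (\<lambda>n. qpoch a p n * qpoch (- a) p n)"
    by (rule ext)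
       (simp add: qpoch_def prod.distrib[symmetric] power2_eq_square algebra_simps power_mult_distrib)
  thus "qpoch (a\<^sup>2) (p\<^sup>2) \<longlonglongrightarrow> qpoch_inf a p * qpoch_inf (- a) p"
    using assms by (auto intro!: tendsto_mult qpoch_tendsto)
qed

lemma qpoch_bounded:
  assumes "norm p < 1"
  obtains K where "K > 0" "\<And>n. norm (qpoch a p n) \<le> K"
  using convergent_imp_Bseq[OF convergentI[OF qpoch_tendsto[OF assms]]] by (auto simp: Bseq_def)

text \<open>
  The limit of the finite products is nonzero, so their reciprocals converge too. This is what bounds
  denominators uniformly in all estimates below.
\<close>

lemma inverse_qpoch_bounded:
  assumes "norm p < 1" "\<And>n. a * p ^ n \<noteq> 1"
  obtains K where "K > 0" "\<And>n. norm (inverse (qpoch a p n)) \<le> K"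
  using convergent_imp_Bseq[OF convergentI[OF tendsto_inverse[OF qpoch_tendsto[OF assms(1)]
          qpoch_inf_nonzero[OF assms]]]]
  by (auto simp: Bseq_def)

section \<open>Partial theta series\<close>

text \<open>The ratio \<open>x * p ^ Suc n\<close> of consecutive terms tends to \<open>0\<close>, whatever the size of \<open>x\<close>.\<close>

lemma summable_partial_theta:
  fixes x p :: complex
  assumes "norm p < 1"
  shows "summable (\<lambda>n. norm (x ^ n * p ^ triangle n))"
proof -
  have "(\<lambda>n. norm (x * p ^ Suc n)) \<longlonglongrightarrow> 0"
    using assms LIMSEQ_Suc[OF LIMSEQ_power_zero[of p]] by (auto intro!: tendsto_norm_zero tendsto_mult_right_zero simp del: power_Suc)
  hence "eventually (\<lambda>n. norm (x * p ^ Suc n) < 1 / 2) sequentially"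
    by (rule order_tendstoD) simp
  then obtain N where N: "norm (x * p ^ Suc n) < 1 / 2" if "n \<ge> N" for n
    by (auto simp: eventually_at_top_linorder)
  show ?thesis
  proof (rule summable_ratio_test[of "1 / 2" N])
    fix n assume "n \<ge> N"
    have "x ^ Suc n * p ^ triangle (Suc n) = (x * p ^ Suc n) * (x ^ n * p ^ triangle n)"
      by (simp add: power_add)
    hence "norm (x ^ Suc n * p ^ triangle (Suc n)) = norm (x * p ^ Suc n) * norm (x ^ n * p ^ triangle n)"
      by (metis norm_mult)
    also have "\<dots> \<le> 1 / 2 * norm (x ^ n * p ^ triangle n)"
      using N[OF \<open>n \<ge> N\<close>] by (intro mult_right_mono) auto
    finally show "norm (norm (x ^ Suc n * p ^ triangle (Suc n))) \<le> 1 / 2 * norm (norm (x ^ n * p ^ triangle n))"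
      by simp
  qed simp
qed

lemma triangle_add: "triangle (j + m) = triangle j + j * m + triangle m"
  by (induction m) auto

section \<open>A transformation of the Rogers--Fine series\<close>

text \<open>The function that Fine denotes by \<open>F(\<beta>, \<gamma>; z)\<close>, with base \<open>p\<close>.\<close>

definition rogers_fine :: "complex \<Rightarrow> complex \<Rightarrow> complex \<Rightarrow> complex \<Rightarrow> complex" where
  "rogers_fine \<beta> \<gamma> z p = (\<Sum>m. qpoch (\<beta> * p) p m / qpoch (\<gamma> * p) p m * z ^ m)"

text \<open>
  The quotients \<open>qpoch (\<gamma> * p ^ Suc N) p m = qpoch (\<gamma> * p) p (N + m) / qpoch (\<gamma> * p) p N\<close> are bounded
  away from \<open>0\<close> uniformly in \<open>N\<close> and \<open>m\<close>, so one geometric series in \<open>norm z\<close> dominates all the series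
  with shifted parameters. The bound controls the remainder when the recurrence below is iterated.
\<close>

lemma summable_rogers_fine:
  assumes "norm p < 1" "\<And>n. \<gamma> * p ^ Suc n \<noteq> 1" "norm z < 1"
  shows "summable (\<lambda>m. qpoch (\<beta> * p) p m / qpoch (\<gamma> * p) p m * z ^ m)"
    and rogers_fine_shift_bounded: "\<exists>K. \<forall>N. norm (rogers_fine \<beta> (\<gamma> * p ^ N) (z * p ^ N) p) \<le> K"
proof -
  have nz: "\<gamma> * p * p ^ n \<noteq> 1" for n
    using assms(2)[of n] by (simp add: mult.assoc)
  obtain A where A: "A > 0" "\<And>n. norm (qpoch (\<beta> * p) p n) \<le> A"
    using qpoch_bounded[OF assms(1)] by blast
  obtain B where B: "B > 0" "\<And>n. norm (qpoch (\<gamma> * p) p n) \<le> B"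
    using qpoch_bounded[OF assms(1)] by blast
  obtain C where C: "C > 0" "\<And>n. norm (inverse (qpoch (\<gamma> * p) p n)) \<le> C"
    using inverse_qpoch_bounded[OF assms(1) nz] by blast
  have bd: "norm (qpoch (\<beta> * p) p m / qpoch (\<gamma> * p ^ N * p) p m * (z * p ^ N) ^ m)
             \<le> (A * (B * C)) * norm z ^ m" for N m
  proof -
    have "qpoch (\<gamma> * p) p (N + m) = qpoch (\<gamma> * p) p N * qpoch (\<gamma> * p ^ N * p) p m"
      by (simp add: qpoch_add mult_ac)
    hence "inverse (qpoch (\<gamma> * p ^ N * p) p m) =
             qpoch (\<gamma> * p) p N * inverse (qpoch (\<gamma> * p) p (N + m))"
      using qpoch_nonzero[of "\<gamma> * p" p N] nz by (simp add: field_simps)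
    hence "norm (inverse (qpoch (\<gamma> * p ^ N * p) p m)) \<le> B * C"
      using B C by (simp only: norm_mult) (intro mult_mono, auto)
    moreover have "norm ((z * p ^ N) ^ m) \<le> norm z ^ m"
      unfolding norm_power norm_mult using assms
      by (intro power_mono mult_left_le power_le_one) auto
    ultimately show ?thesis
      unfolding divide_inverse norm_mult[of _ "(z * p ^ N) ^ m"] norm_mult[of _ "inverse _"]
      using A B C by (intro mult_mono) auto
  qed
  have geo: "summable (\<lambda>m. (A * (B * C)) * norm z ^ m)"
    using assms by (intro summable_mult summable_geometric) auto
  show "summable (\<lambda>m. qpoch (\<beta> * p) p m / qpoch (\<gamma> * p) p m * z ^ m)"
    using bd[of _ 0] by (intro summable_comparison_test'[OF geo]) simp
  have "norm (rogers_fine \<beta> (\<gamma> * p ^ N) (z * p ^ N) p) \<le> (\<Sum>m. (A * (B * C)) * norm z ^ m)" for N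
    unfolding rogers_fine_def by (rule norm_suminf_le[OF bd geo])
  thus "\<exists>K. \<forall>N. norm (rogers_fine \<beta> (\<gamma> * p ^ N) (z * p ^ N) p) \<le> K" by blast
qed

text \<open>
  Multiplying by \<open>1 - z\<close> replaces the coefficients by their consecutive differences. In
  \<open>f (Suc m) - z * f m\<close> the numerator becomes
  \<open>(1 - \<beta> p ^ Suc m) - (1 - \<gamma> p ^ Suc m) = - (\<beta> - \<gamma>) p ^ Suc m\<close>, and the new factor \<open>p ^ m\<close> is absorbed
  into \<open>z ^ m\<close>: the difference is again a series of the same kind.
\<close>

lemma rogers_fine_rec:
  assumes "norm p < 1" "\<And>n. \<gamma> * p ^ Suc n \<noteq> 1" "norm z < 1"
  shows "rogers_fine \<beta> \<gamma> z p =
           1 / (1 - z) - (\<beta> - \<gamma>) * p * z / ((1 - \<gamma> * p) * (1 - z)) * rogers_fine \<beta> (\<gamma> * p) (z * p) p"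
proof -
  define f where "f m = qpoch (\<beta> * p) p m / qpoch (\<gamma> * p) p m * z ^ m" for m
  define g where "g m = qpoch (\<beta> * p) p m / qpoch (\<gamma> * p * p) p m * (z * p) ^ m" for m
  define d where "d = (\<beta> - \<gamma>) * p * z / (1 - \<gamma> * p)"
  have nz: "\<gamma> * p * p ^ n \<noteq> 1" for n
    using assms(2)[of n] by (simp add: mult.assoc)
  have zp: "norm (z * p) < 1"
    using assms mult_strict_mono[of "norm z" 1 "norm p" 1] by (simp add: norm_mult)
  have "summable f"
    unfolding f_def by (rule summable_rogers_fine[OF assms])
  have "summable g"
    unfolding g_def using nz by (intro summable_rogers_fine assms(1) zp) (metis mult.assoc power_Suc)
  have step: "f (Suc m) - z * f m = - d * g m" for m
  proof -
    have 1: "1 - \<gamma> * p * p ^ m \<noteq> 0" "1 - \<gamma> * p \<noteq> 0"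
      using nz[of m] nz[of 0] by simp_all
    have 2: "qpoch (\<gamma> * p) p m \<noteq> 0" using nz by (rule qpoch_nonzero)
    have 3: "(1 - \<gamma> * p) * qpoch (\<gamma> * p * p) p m = qpoch (\<gamma> * p) p m * (1 - \<gamma> * p * p ^ m)"
      by (metis qpoch_Suc qpoch_Suc_shift)
    have "d * g m = (\<beta> - \<gamma>) * p * z * qpoch (\<beta> * p) p m * (z * p) ^ m
                      / ((1 - \<gamma> * p) * qpoch (\<gamma> * p * p) p m)"
      by (simp add: d_def g_def)
    also have "\<dots> = (\<beta> - \<gamma>) * p * z * qpoch (\<beta> * p) p m * (z * p) ^ m
                      / (qpoch (\<gamma> * p) p m * (1 - \<gamma> * p * p ^ m))"
      unfolding 3 ..
    finally show ?thesis
      using 1 2 by (simp add: f_def qpoch_Suc divide_simps) (simp add: algebra_simps power_mult_distrib)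
  qed
  have "suminf f = 1 + (\<Sum>m. f (Suc m))"
    using suminf_split_head[OF \<open>summable f\<close>] by (simp add: f_def)
  moreover have "z * suminf f = (\<Sum>m. z * f m)"
    using \<open>summable f\<close> by (simp add: suminf_mult)
  ultimately have "(1 - z) * suminf f = 1 + ((\<Sum>m. f (Suc m)) - (\<Sum>m. z * f m))"
    by (simp add: left_diff_distrib)
  also have "\<dots> = 1 + (\<Sum>m. f (Suc m) - z * f m)"
    using \<open>summable f\<close> suminf_diff[of "\<lambda>m. f (Suc m)" "\<lambda>m. z * f m"]
    by (simp add: summable_Suc_iff summable_mult)
  also have "\<dots> = 1 - d * suminf g"
    unfolding step using \<open>summable g\<close> suminf_mult[of g "- d"] by simp
  finally have "(1 - z) * rogers_fine \<beta> \<gamma> z p = 1 - d * rogers_fine \<beta> (\<gamma> * p) (z * p) p"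
    by (simp add: rogers_fine_def f_def[abs_def] g_def[abs_def])
  moreover have "1 - z \<noteq> 0" using assms by auto
  ultimately have "rogers_fine \<beta> \<gamma> z p = (1 - d * rogers_fine \<beta> (\<gamma> * p) (z * p) p) / (1 - z)"
    by (simp add: field_simps)
  thus ?thesis
    by (simp add: d_def diff_divide_distrib)
qed

text \<open>
  This is the transformation of a \<open>\<^sub>2\<phi>\<^sub>1\<close> into a \<open>\<^sub>2\<phi>\<^sub>2\<close> in the case where one numerator parameter is
  the base. Iterating the recurrence \<open>N\<close> times produces the first \<open>N\<close> terms of the right-hand series
  plus the remainder \<open>c N * R N\<close>. It vanishes in the limit because \<open>R\<close> is bounded and \<open>c N\<close> contains
  the factor \<open>p ^ triangle N\<close>.
\<close>

theorem rogers_fine_sums: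
  assumes "norm p < 1" "\<beta> \<noteq> 0" "\<And>n. \<gamma> * p ^ Suc n \<noteq> 1" "norm z < 1"
  shows "(\<lambda>n. qpoch (\<gamma> / \<beta>) p n * (- (\<beta> * z)) ^ n * p ^ triangle n /
                (qpoch (\<gamma> * p) p n * qpoch z p (Suc n))) sums rogers_fine \<beta> \<gamma> z p"
proof -
  define c where "c n = qpoch (\<gamma> / \<beta>) p n * (- (\<beta> * z)) ^ n * p ^ triangle n /
                (qpoch (\<gamma> * p) p n * qpoch z p n)" for n
  define R where "R N = rogers_fine \<beta> (\<gamma> * p ^ N) (z * p ^ N) p" for N
  have nz: "\<gamma> * p * p ^ n \<noteq> 1" for n
    using assms(3)[of n] by (simp add: mult.assoc)
  have nz': "z * p ^ n \<noteq> 1" for n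
    using assms by (intro mult_power_neq_1)
  have R_rec: "R N = 1 / (1 - z * p ^ N)
      - (\<beta> - \<gamma> * p ^ N) * p * (z * p ^ N) / ((1 - \<gamma> * p * p ^ N) * (1 - z * p ^ N)) * R (Suc N)" for N
  proof -
    have "norm (z * p ^ N) < 1"
      using assms mult_right_le_one_le[of "norm z" "norm p ^ N"]
      by (auto simp: norm_mult norm_power power_le_one intro: le_less_trans)
    moreover have "\<gamma> * p ^ N * p ^ Suc n \<noteq> 1" for n
      using nz[of "N + n"] by (simp add: power_add mult_ac)
    ultimately show ?thesis
      using rogers_fine_rec[OF assms(1), of "\<gamma> * p ^ N" "z * p ^ N" \<beta>]
      by (simp add: R_def mult_ac)
  qed
  have c_Suc: "c (Suc n) = - c n * ((\<beta> - \<gamma> * p ^ n) * p * (z * p ^ n) / ((1 - \<gamma> * p * p ^ n) * (1 - z * p ^ n)))" for n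
  proof -
    have "\<beta> - \<gamma> * p ^ n = \<beta> * (1 - \<gamma> / \<beta> * p ^ n)"
      using assms(2) by (simp add: field_simps)
    thus ?thesis
      by (simp add: c_def qpoch_Suc power_add mult_ac)
  qed
  have partial: "(\<Sum>n<N. c n / (1 - z * p ^ n)) + c N * R N = rogers_fine \<beta> \<gamma> z p" for N
  proof (induction N)
    case 0
    show ?case by (simp add: c_def R_def)
  next
    case (Suc N)
    have "c N / (1 - z * p ^ N) + c (Suc N) * R (Suc N) = c N * R N"
      unfolding R_rec[of N] c_Suc by (simp only: right_diff_distrib) simp
    with Suc show ?case by (simp add: add.assoc)
  qed
  have "(\<lambda>n. (- (\<beta> * z)) ^ n * p ^ triangle n) \<longlonglongrightarrow> 0"
    using summable_LIMSEQ_zero[OF summable_partial_theta[OF assms(1)]]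
    by (simp add: tendsto_norm_zero_iff)
  hence "(\<lambda>n. qpoch (\<gamma> / \<beta>) p n * ((- (\<beta> * z)) ^ n * p ^ triangle n) /
                (qpoch (\<gamma> * p) p n * qpoch z p n))
           \<longlonglongrightarrow> qpoch_inf (\<gamma> / \<beta>) p * 0 / (qpoch_inf (\<gamma> * p) p * qpoch_inf z p)"
    using qpoch_inf_nonzero[OF assms(1) nz] qpoch_inf_nonzero[OF assms(1) nz']
    by (intro tendsto_intros qpoch_tendsto assms(1)) auto
  hence "c \<longlonglongrightarrow> 0"
    by (simp add: c_def[abs_def] mult.assoc)
  moreover obtain K where "norm (R N) \<le> K" for N
    using rogers_fine_shift_bounded[OF assms(1,3,4), of \<beta>] unfolding R_def[symmetric] by blast
  ultimately have "(\<lambda>N. c N * R N) \<longlonglongrightarrow> 0"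
    by (intro lim_null_mult_right_bounded[where B = K] always_eventually) auto
  hence "(\<lambda>N. rogers_fine \<beta> \<gamma> z p - c N * R N) \<longlonglongrightarrow> rogers_fine \<beta> \<gamma> z p - 0"
    by (intro tendsto_intros)
  moreover have "(\<lambda>N. rogers_fine \<beta> \<gamma> z p - c N * R N) = (\<lambda>N. \<Sum>n<N. c n / (1 - z * p ^ n))"
    using partial by (intro ext) (simp add: eq_diff_eq[symmetric])
  ultimately have "(\<lambda>n. c n / (1 - z * p ^ n)) sums rogers_fine \<beta> \<gamma> z p"
    by (simp add: sums_def)
  thus ?thesis
    by (simp add: c_def qpoch_Suc mult_ac)
qed


section \<open>The Jacobi triple product\<close>

text \<open>The Gaussian binomial coefficient, evaluated at \<open>p\<close>; it is meant for \<open>p\<close> not a root of unity.\<close>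

definition qbinom :: "complex \<Rightarrow> nat \<Rightarrow> nat \<Rightarrow> complex" where
  "qbinom p n k = (if k \<le> n then qpoch p p n / (qpoch p p k * qpoch p p (n - k)) else 0)"

lemma qbinom_0_right:
  assumes "norm p < 1"
  shows "qbinom p n 0 = 1"
  using qpoch_nonzero[OF mult_power_neq_1[OF assms assms]] by (simp add: qbinom_def)

lemma qbinom_symmetric: "k \<le> n \<Longrightarrow> qbinom p n (n - k) = qbinom p n k"
  by (simp add: qbinom_def mult.commute)

lemma qbinom_Suc_Suc:
  assumes "norm p < 1"
  shows "qbinom p (Suc n) (Suc k) = qbinom p n (Suc k) + p ^ (n - k) * qbinom p n k"
proof -
  have nz: "qpoch p p m \<noteq> 0" for m
    using mult_power_neq_1[OF assms assms] by (rule qpoch_nonzero)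
  have nz': "1 - p * p ^ m \<noteq> 0" for m
    using mult_power_neq_1[OF assms assms, of m] by simp
  consider "k < n" | "k = n" | "k > n" by linarith
  thus ?thesis
  proof cases
    case 1
    then obtain d where d: "n = Suc (k + d)" using less_imp_Suc_add by blast
    have "Suc n - Suc k = Suc d" "n - Suc k = d" "n - k = Suc d" "Suc k \<le> n" "k \<le> n"
      using d by auto
    thus ?thesis
      using nz[of k] nz[of d] nz'[of k] nz'[of d] unfolding qbinom_def
      by (simp add: qpoch_Suc[of p p n] qpoch_Suc[of p p k] qpoch_Suc[of p p d] divide_simps)
         (simp add: d power_add algebra_simps)
  next
    case 2
    thus ?thesis using nz nz' by (simp add: qbinom_def)
  qed (simp add: qbinom_def)
qed

text \<open>
  The extra factor \<open>1 + w * p ^ Suc n\<close> matches the two summands in the Pascal rule: the power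
  \<open>p ^ (n - j)\<close> there and the \<open>p ^ Suc j\<close> gained from \<open>triangle j\<close> to \<open>triangle (Suc j)\<close> combine to
  \<open>p ^ Suc n\<close>, independently of \<open>j\<close>.
\<close>

lemma q_binomial_theorem:
  assumes "norm p < 1"
  shows "qpoch (- (w * p)) p n = (\<Sum>j\<le>n. qbinom p n j * (w ^ j * p ^ triangle j))"
proof (induction n)
  case 0
  show ?case by (simp add: qbinom_def)
next
  case (Suc n)
  define t where "t j = w ^ j * p ^ triangle j" for j
  have "(\<Sum>j\<le>Suc n. qbinom p (Suc n) j * t j) =
          1 + (\<Sum>j\<le>n. qbinom p (Suc n) (Suc j) * t (Suc j))"
    by (subst sum.atMost_Suc_shift) (simp add: qbinom_0_right[OF assms] t_def)
  also have "\<dots> = (1 + (\<Sum>j\<le>n. qbinom p n (Suc j) * t (Suc j)))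
                    + (\<Sum>j\<le>n. p ^ (n - j) * qbinom p n j * t (Suc j))"
    by (simp add: qbinom_Suc_Suc[OF assms] sum.distrib algebra_simps)
  also have "1 + (\<Sum>j\<le>n. qbinom p n (Suc j) * t (Suc j)) = (\<Sum>j\<le>Suc n. qbinom p n j * t j)"
    by (subst sum.atMost_Suc_shift) (simp add: qbinom_0_right[OF assms] t_def)
  also have "\<dots> = (\<Sum>j\<le>n. qbinom p n j * t j)"
    by (simp add: qbinom_def)
  also have "(\<Sum>j\<le>n. p ^ (n - j) * qbinom p n j * t (Suc j)) =
               w * p * p ^ n * (\<Sum>j\<le>n. qbinom p n j * t j)"
    unfolding sum_distrib_left
  proof (rule sum.cong)
    fix j assume "j \<in> {..n}"
    hence "p ^ n = p ^ (n - j) * p ^ j" by (simp add: power_add[symmetric])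
    thus "p ^ (n - j) * qbinom p n j * t (Suc j) = w * p * p ^ n * (qbinom p n j * t j)"
      by (simp add: t_def power_add mult_ac)
  qed simp
  finally have "(\<Sum>j\<le>Suc n. qbinom p (Suc n) j * t j) =
                  (1 + w * p * p ^ n) * (\<Sum>j\<le>n. qbinom p n j * t j)"
    by (simp only: distrib_right mult_1_left)
  thus ?case
    using Suc.IH by (simp only: qpoch_Suc t_def) simp
qed

text \<open>
  This is the \<open>q\<close>-binomial theorem for a product of length \<open>2 n\<close>, centred at its middle term: with
  \<open>w = x / p ^ n\<close> the last \<open>n\<close> factors form \<open>qpoch (- (x * p)) p n\<close>, while the first \<open>n\<close> factors, each
  divided by its leading monomial \<open>w * p ^ Suc i\<close> and taken in reverse order, form
  \<open>qpoch (- (1 / x)) p n\<close>. The product of these monomials is the middle power \<open>t n\<close>, which is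
  cancelled on both sides.
\<close>

lemma finite_jacobi_triple_product:
  assumes "norm p < 1" "p \<noteq> 0" "x \<noteq> 0"
  shows "qpoch (- (x * p)) p n * qpoch (- (1 / x)) p n =
           (\<Sum>k<Suc n. qbinom p (2 * n) (n + k) * (x ^ k * p ^ triangle k)) +
           1 / x * (\<Sum>k<n. qbinom p (2 * n) (n + Suc k) * ((1 / x) ^ k * p ^ triangle k))"
proof -
  define w where "w = x / p ^ n"
  define t where "t j = w ^ j * p ^ triangle j" for j
  have "w \<noteq> 0" using assms by (simp add: w_def)
  hence t_nz: "t j \<noteq> 0" for j using assms by (simp add: t_def)
  have t_add: "t (j + m) = t j * ((w * p ^ j) ^ m * p ^ triangle m)" for j m
    by (simp add: t_def triangle_add power_add power_mult power_mult_distrib mult_ac)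
  have upper: "t (n + k) = t n * (x ^ k * p ^ triangle k)" for k
    using assms by (simp add: t_add w_def)
  have lower: "t (n - Suc k) = t n * (1 / x * ((1 / x) ^ k * p ^ triangle k))" if "k < n" for k
  proof -
    define j where "j = n - Suc k"
    have n: "n = j + Suc k" using that by (simp add: j_def)
    have "w * p ^ j = x / p ^ Suc k"
      using assms by (simp add: w_def n power_add field_simps)
    hence "t n = t j * ((x / p ^ Suc k) ^ Suc k * p ^ triangle (Suc k))"
      unfolding n t_add by simp
    also have "(p ^ Suc k) ^ Suc k = p ^ triangle (Suc k) * p ^ triangle k"
    proof -
      have "Suc k * Suc k = triangle (Suc k) + triangle k"
        by (induction k) simp_all
      thus ?thesis by (simp only: power_mult[symmetric] power_add[symmetric])
    qed
    hence "(x / p ^ Suc k) ^ Suc k * p ^ triangle (Suc k) = x ^ Suc k / p ^ triangle k"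
      using assms by (simp only: power_divide) (simp add: field_simps)
    finally show ?thesis
      using assms by (simp add: j_def field_simps)
  qed
  have "qpoch (- (w * p)) p n = (\<Prod>i<n. 1 + w * p ^ Suc i)"
    by (simp add: qpoch_def mult_ac)
  also have "\<dots> = (\<Prod>i<n. w * p ^ Suc i) * (\<Prod>i<n. 1 + 1 / (w * p ^ Suc i))"
    using assms \<open>w \<noteq> 0\<close> by (subst prod.distrib[symmetric], intro prod.cong) (auto simp: field_simps)
  also have "(\<Prod>i<n. w * p ^ Suc i) = t n"
    unfolding t_def by (induction n) (simp_all add: power_add mult_ac)
  also have "(\<Prod>i<n. 1 + 1 / (w * p ^ Suc i)) = (\<Prod>i<n. 1 + 1 / (w * p ^ Suc (n - Suc i)))"
    by (rule prod.nat_diff_reindex[symmetric])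
  also have "\<dots> = qpoch (- (1 / x)) p n"
    unfolding qpoch_def
  proof (rule prod.cong)
    fix i assume i: "i \<in> {..<n}"
    hence "p ^ n = p ^ Suc (n - Suc i) * p ^ i"
      by (simp only: power_add[symmetric]) simp
    hence "w * p ^ Suc (n - Suc i) = x / p ^ i"
      using assms by (simp only: w_def) (simp add: field_simps)
    thus "1 + 1 / (w * p ^ Suc (n - Suc i)) = 1 - - (1 / x) * p ^ i"
      by simp
  qed simp
  finally have "qpoch (- (w * p)) p (2 * n) = t n * (qpoch (- (x * p)) p n * qpoch (- (1 / x)) p n)"
    using assms qpoch_add[of "- (w * p)" p n n] by (simp add: w_def mult_2)
  also have "qpoch (- (w * p)) p (2 * n) = (\<Sum>j\<le>2 * n. qbinom p (2 * n) j * t j)"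
    unfolding t_def by (rule q_binomial_theorem[OF assms(1)])
  also have "\<dots> = (\<Sum>j<n. qbinom p (2 * n) j * t j) + (\<Sum>j=n..<2 * n + 1. qbinom p (2 * n) j * t j)"
    by (simp add: lessThan_Suc_atMost[symmetric] sum.atLeastLessThan_concat lessThan_atLeast0 del: sum.op_ivl_Suc)
  also have "(\<Sum>j=n..<2 * n + 1. qbinom p (2 * n) j * t j) =
               (\<Sum>k<Suc n. qbinom p (2 * n) (n + k) * t (n + k))"
    using sum.shift_bounds_nat_ivl[of "\<lambda>j. qbinom p (2 * n) j * t j" 0 n "Suc n"]
    by (simp add: lessThan_atLeast0 add.commute mult_2 del: sum.op_ivl_Suc)
  also have "(\<Sum>j<n. qbinom p (2 * n) j * t j) =
               (\<Sum>k<n. qbinom p (2 * n) (n - Suc k) * t (n - Suc k))"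
    by (rule sum.nat_diff_reindex[symmetric])
  also have "\<dots> = (\<Sum>k<n. t n * (1 / x * (qbinom p (2 * n) (n + Suc k) * ((1 / x) ^ k * p ^ triangle k))))"
  proof (rule sum.cong)
    fix k assume "k \<in> {..<n}"
    moreover from this have "qbinom p (2 * n) (n - Suc k) = qbinom p (2 * n) (n + Suc k)"
      using qbinom_symmetric[of "n + Suc k" "2 * n" p] by simp
    ultimately show "qbinom p (2 * n) (n - Suc k) * t (n - Suc k) =
        t n * (1 / x * (qbinom p (2 * n) (n + Suc k) * ((1 / x) ^ k * p ^ triangle k)))"
      by (simp add: lower)
  qed simp
  also have "(\<Sum>k<Suc n. qbinom p (2 * n) (n + k) * t (n + k)) =
               t n * (\<Sum>k<Suc n. qbinom p (2 * n) (n + k) * (x ^ k * p ^ triangle k))"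
    unfolding upper sum_distrib_left by (simp add: mult_ac)
  finally have "t n * ((\<Sum>k<Suc n. qbinom p (2 * n) (n + k) * (x ^ k * p ^ triangle k)) +
       1 / x * (\<Sum>k<n. qbinom p (2 * n) (n + Suc k) * ((1 / x) ^ k * p ^ triangle k)))
      = t n * (qpoch (- (x * p)) p n * qpoch (- (1 / x)) p n)"
    by (simp only: sum_distrib_left[symmetric] distrib_left add.commute)
  with t_nz[of n] show ?thesis by simp
qed

text \<open>
  At a fixed distance from the middle, the Gaussian binomial coefficients of \<open>2 n\<close> tend to \<open>1 / qpoch_inf p p\<close>, and all
  of them are bounded by a constant that does not depend on \<open>n\<close>, so Tannery's theorem applies.
  The offset \<open>d\<close> serves both halves of the triple product.
\<close>

lemma qbinom_sum_tendsto:
  fixes u :: "nat \<Rightarrow> complex"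
  assumes "norm p < 1" "summable (\<lambda>k. norm (u k))"
  shows "(\<lambda>n. \<Sum>k. qbinom p (2 * n) (n + d + k) * u k) \<longlonglongrightarrow> (\<Sum>k. 1 / qpoch_inf p p * u k)"
proof -
  note nz = mult_power_neq_1[OF assms(1) assms(1)]
  obtain A where A: "A > 0" "\<And>n. norm (qpoch p p n) \<le> A"
    using qpoch_bounded[OF assms(1)] by blast
  obtain B where B: "B > 0" "\<And>n. norm (inverse (qpoch p p n)) \<le> B"
    using inverse_qpoch_bounded[OF assms(1) nz] by blast
  have bd: "norm (qbinom p n k) \<le> A * (B * B)" for n k
  proof (cases "k \<le> n")
    case True
    have "norm (qbinom p n k) =
            norm (qpoch p p n) * (norm (inverse (qpoch p p k)) * norm (inverse (qpoch p p (n - k))))"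
      using True by (simp add: qbinom_def divide_inverse norm_mult)
    also have "\<dots> \<le> A * (B * B)"
      using A B by (intro mult_mono) auto
    finally show ?thesis .
  qed (use A B in \<open>simp add: qbinom_def\<close>)
  have lim: "(\<lambda>n. qbinom p (2 * n) (n + d + k)) \<longlonglongrightarrow> 1 / qpoch_inf p p" for k
  proof -
    have "(\<lambda>n. qpoch p p (2 * n) / (qpoch p p (n + (d + k)) * qpoch p p (n - (d + k))))
            \<longlonglongrightarrow> qpoch_inf p p / (qpoch_inf p p * qpoch_inf p p)"
    proof (intro tendsto_divide tendsto_mult)
      show "(\<lambda>n. qpoch p p (2 * n)) \<longlonglongrightarrow> qpoch_inf p p"
        by (rule filterlim_compose[OF qpoch_tendsto[OF assms(1)]])
           (auto intro: filterlim_subseq simp: strict_mono_def)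
      show "(\<lambda>n. qpoch p p (n + (d + k))) \<longlonglongrightarrow> qpoch_inf p p"
        using qpoch_tendsto[OF assms(1)] by (rule LIMSEQ_ignore_initial_segment)
      show "(\<lambda>n. qpoch p p (n - (d + k))) \<longlonglongrightarrow> qpoch_inf p p"
        by (rule filterlim_compose[OF qpoch_tendsto[OF assms(1)] filterlim_minus_const_nat_at_top])
      show "qpoch_inf p p * qpoch_inf p p \<noteq> 0"
        using qpoch_inf_nonzero[OF assms(1) nz] by simp
    qed
    moreover have "eventually (\<lambda>n. qpoch p p (2 * n) / (qpoch p p (n + (d + k)) * qpoch p p (n - (d + k)))
                      = qbinom p (2 * n) (n + d + k)) sequentially"
      using eventually_ge_at_top[of "d + k"]
      by eventually_elim (simp add: qbinom_def add.assoc mult_2)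
    ultimately have "(\<lambda>n. qbinom p (2 * n) (n + d + k))
                       \<longlonglongrightarrow> qpoch_inf p p / (qpoch_inf p p * qpoch_inf p p)"
      by (rule Lim_transform_eventually)
    thus ?thesis
      using qpoch_inf_nonzero[OF assms(1) nz] by simp
  qed
  show ?thesis
  proof (rule tannerys_theorem[THEN conjunct2, THEN conjunct2])
    show "(\<lambda>n. qbinom p (2 * n) (n + d + k) * u k) \<longlonglongrightarrow> 1 / qpoch_inf p p * u k" for k
      by (intro tendsto_intros lim)
    show "eventually (\<lambda>(k, n). norm (qbinom p (2 * n) (n + d + k) * u k) \<le> A * (B * B) * norm (u k))
            (at_top \<times>\<^sub>F sequentially)"
      using bd by (auto intro!: always_eventually mult_right_mono simp: norm_mult)
    show "summable (\<lambda>k. A * (B * B) * norm (u k))"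
      using assms(2) by (rule summable_mult)
  qed simp
qed

text \<open>
  The bilateral theta series is written as two one-sided ones: the term of index \<open>- n - 1\<close> is
  \<open>1 / x * (1 / x) ^ n * p ^ triangle n\<close>.
\<close>

theorem jacobi_triple_product:
  assumes "norm p < 1" "p \<noteq> 0" "x \<noteq> 0"
  shows "(\<Sum>n. x ^ n * p ^ triangle n) + 1 / x * (\<Sum>n. (1 / x) ^ n * p ^ triangle n) =
           qpoch_inf p p * qpoch_inf (- (x * p)) p * qpoch_inf (- (1 / x)) p"
proof -
  define u where "u y k = y ^ k * p ^ triangle k" for y :: complex and k
  have summ: "summable (\<lambda>k. norm (u y k))" for y
    unfolding u_def by (rule summable_partial_theta[OF assms(1)])
  have "(\<lambda>n. (\<Sum>k. qbinom p (2 * n) (n + 0 + k) * u x k) +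
             1 / x * (\<Sum>k. qbinom p (2 * n) (n + 1 + k) * u (1 / x) k))
          \<longlonglongrightarrow> (\<Sum>k. 1 / qpoch_inf p p * u x k) + 1 / x * (\<Sum>k. 1 / qpoch_inf p p * u (1 / x) k)"
    by (intro tendsto_intros qbinom_sum_tendsto assms(1) summ)
  moreover have "(\<Sum>k. qbinom p (2 * n) (n + 0 + k) * u x k) +
             1 / x * (\<Sum>k. qbinom p (2 * n) (n + 1 + k) * u (1 / x) k) =
           qpoch (- (x * p)) p n * qpoch (- (1 / x)) p n" for n
  proof -
    have "(\<Sum>k. qbinom p (2 * n) (n + 0 + k) * u x k) = (\<Sum>k<Suc n. qbinom p (2 * n) (n + k) * u x k)"
      by (subst suminf_finite[of "{..<Suc n}"]) (auto simp: qbinom_def)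
    moreover have "(\<Sum>k. qbinom p (2 * n) (n + 1 + k) * u (1 / x) k) =
                     (\<Sum>k<n. qbinom p (2 * n) (n + Suc k) * u (1 / x) k)"
      by (subst suminf_finite[of "{..<n}"]) (auto simp: qbinom_def)
    ultimately show ?thesis
      unfolding finite_jacobi_triple_product[OF assms] u_def by simp
  qed
  moreover have "(\<lambda>n. qpoch (- (x * p)) p n * qpoch (- (1 / x)) p n)
                   \<longlonglongrightarrow> qpoch_inf (- (x * p)) p * qpoch_inf (- (1 / x)) p"
    by (intro tendsto_intros qpoch_tendsto assms(1))
  ultimately have "(\<Sum>k. 1 / qpoch_inf p p * u x k) + 1 / x * (\<Sum>k. 1 / qpoch_inf p p * u (1 / x) k)
      = qpoch_inf (- (x * p)) p * qpoch_inf (- (1 / x)) p"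
    by (simp add: LIMSEQ_unique)
  moreover have "(\<Sum>k. 1 / qpoch_inf p p * u y k) = 1 / qpoch_inf p p * suminf (u y)" for y
    by (rule suminf_mult[OF summable_norm_cancel[OF summ]])
  ultimately have "1 / qpoch_inf p p * (suminf (u x) + 1 / x * suminf (u (1 / x))) =
                     qpoch_inf (- (x * p)) p * qpoch_inf (- (1 / x)) p"
    by (simp only: distrib_left mult.left_commute)
  moreover have "qpoch_inf p p \<noteq> 0"
    by (rule qpoch_inf_nonzero[OF assms(1) mult_power_neq_1[OF assms(1) assms(1)]])
  ultimately show ?thesis
    unfolding u_def by (simp add: field_simps)
qed

section \<open>Both identities in terms of $\rho_3$\<close>

text \<open>
  For \<open>c = - a b\<close> the parameter \<open>- c / b\<close> of \<open>rho3\<close> is \<open>a\<close>, so that its denominators are those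
  produced by the transformation with \<open>\<beta> = 1 / b\<close>, \<open>\<gamma> = - a\<close> and \<open>z = a\<close>.
\<close>

lemma rho3_eq_rogers_fine:
  assumes "norm p < 1" "b \<noteq> 0" "norm a < 1"
  shows "rho3 a b (- (a * b)) p = (1 + 1 / b) * rogers_fine (1 / b) (- a) a p"
proof -
  have "- a * p ^ Suc n \<noteq> 1" for n
    using mult_power_neq_1[of "- a" p "Suc n"] assms by simp
  from rogers_fine_sums[OF assms(1) _ this assms(3), of "1 / b"]
  have "(\<lambda>n. qpoch (- (a * b)) p n * (- (a / b)) ^ n * p ^ triangle n /
              (qpoch (- (a * p)) p n * qpoch a p (Suc n))) sums rogers_fine (1 / b) (- a) a p"
    using assms by (simp add: mult_ac)
  moreover have "qpoch (- (a * b)) p n * (-1) ^ n * p ^ (n * (n + 1) div 2) * a ^ n * b powi (- int n) /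
           (qpoch (- (a * p)) p n * qpoch (- (- (a * b) / b)) p (n + 1))
       = qpoch (- (a * b)) p n * (- (a / b)) ^ n * p ^ triangle n /
              (qpoch (- (a * p)) p n * qpoch a p (Suc n))" for n
  proof -
    have "(- (a / b)) ^ n = (-1) ^ n * a ^ n * b powi (- int n)"
      using power_mult_distrib[of "-1" "a / b" n]
      by (simp add: power_int_minus power_divide) (simp add: divide_inverse)
    thus ?thesis using assms by (simp add: triangle_def mult_ac)
  qed
  ultimately show ?thesis
    by (simp add: rho3_def sums_iff)
qed

text \<open>
  The series in \<open>F\<close> starts with the factorials of length \<open>m + 1\<close>. Splitting off their first factors
  gives a Rogers--Fine series, and \<open>1 - 1 / b = - (1 - b) / b\<close> cancels the prefactor \<open>1 / (1 - b)\<close>. The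
  remaining \<open>1 / b\<close> combines with the factor \<open>1 + 1 / b\<close> of \<open>rho3\<close> to \<open>1 / (1 + b)\<close>.
\<close>

lemma F_eq_rho3:
  fixes a b q :: complex
  assumes "q \<noteq> 0" "norm q < 1" "a \<noteq> 0" "b \<noteq> 0" "norm a < 1" "norm b < 1"
  defines "p \<equiv> q\<^sup>2"
  shows "F (- (a / b)) (a / q) q =
    p / (qpoch_inf (b * q) p * qpoch_inf (a * q) p) *
    (1 / b * (qpoch_inf (- (a * b)) p / (qpoch_inf (a\<^sup>2) (p\<^sup>2) * qpoch_inf (b\<^sup>2) (p\<^sup>2)) *
       (\<Sum>n. (- (a / b)) ^ n * p ^ triangle n))
     - rho3 a b (- (a * b)) p / ((1 + a) * (1 + b)))"
proof -
  have p: "norm p < 1" using assms by (simp add: p_def norm_power power_less_one_iff)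
  have nz: "- a * p ^ Suc n \<noteq> 1" for n
    using mult_power_neq_1[of "- a" p "Suc n"] assms p by simp
  have ab: "1 + a \<noteq> 0" "1 + b \<noteq> 0" "1 - b \<noteq> 0"
    using mult_power_neq_1[of "-a" p 0] mult_power_neq_1[of "-b" p 0] mult_power_neq_1[of b p 0] assms p
    by (auto simp: add_eq_0_iff)
  have "(\<Sum>m. qpoch (1 / b) p (m + 1) / qpoch (- a) p (m + 1) * a ^ m) =
          (\<Sum>m. (1 - 1 / b) / (1 + a) * (qpoch (1 / b * p) p m / qpoch (- a * p) p m * a ^ m))"
    by (simp add: qpoch_Suc_shift mult.assoc)
  also have "\<dots> = (1 - 1 / b) / (1 + a) * rogers_fine (1 / b) (- a) a p"
    unfolding rogers_fine_def by (intro suminf_mult summable_rogers_fine p nz assms)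
  also have "\<dots> / (1 - b) = - (rho3 a b (- (a * b)) p / ((1 + a) * (1 + b)))"
    using ab assms(4) unfolding rho3_eq_rogers_fine[OF p assms(4,5)] by (simp add: divide_simps) (simp add: algebra_simps)
  finally have S: "(\<Sum>m. qpoch (1 / b) p (m + 1) / qpoch (- a) p (m + 1) * a ^ m) / (1 - b) = \<dots>" .
  hence S': "p / (1 - b) * (\<Sum>m. qpoch (1 / b) p (m + 1) / qpoch (- a) p (m + 1) * a ^ m) =
               - (p * (rho3 a b (- (a * b)) p / ((1 + a) * (1 + b))))"
    unfolding times_divide_eq_left times_divide_eq_right[symmetric] S by simp
  have T: "p ^ triangle n = q ^ (n\<^sup>2 + n)" for n
  proof -
    have "2 * triangle n = n\<^sup>2 + n" by (induction n) (simp_all add: power2_eq_square)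
    thus ?thesis by (simp add: p_def power_mult[symmetric])
  qed
  have 1: "a / q * q\<^sup>2 = a * q" "- (a * q / - (a / b)) = b * q" "a / q * q = a" "1 + a / - (a / b) = 1 - b"
    "- (- (a / b) / a) = 1 / b" "- (a / b) * q / (a / q) = - (p / b)" "(a / q)\<^sup>2 * q\<^sup>2 = a\<^sup>2"
    "a\<^sup>2 / - (a / b) = - (a * b)" "a\<^sup>2 / (- (a / b))\<^sup>2 = b\<^sup>2" "q ^ 4 = p\<^sup>2"
    using assms(1,3,4) by (simp_all add: p_def power2_eq_square field_simps eval_nat_numeral)
  show ?thesis
    unfolding F_def 1 unfolding T[symmetric] p_def[symmetric] S'
    by (simp add: right_diff_distrib add.commute)
qed

theorem corollary4p5:
  fixes q \<alpha> z a b c :: complex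
  assumes "q \<noteq> 0" and "\<alpha> \<noteq> 0" and "z \<noteq> 0"
    and "norm q < 1" and "norm (z * q) < 1" and "norm (z * q / \<alpha>) < 1"
    and "a = z * q" and "b = - (z * q / \<alpha>)" and "c = z\<^sup>2 * q\<^sup>2 / \<alpha>"
  shows "F \<alpha> z q = F (1 / \<alpha>) (- (z / \<alpha>)) q \<longleftrightarrow>
    rho3 a b c (q\<^sup>2) - rho3 b a c (q\<^sup>2) =
      (1 / b - 1 / a) *
      (qpochs_inf [c, a * q\<^sup>2 / b, b * q\<^sup>2 / a, q\<^sup>2] (q\<^sup>2) /
       qpochs_inf [- (c / a), - (c / b), - (a * q\<^sup>2), - (b * q\<^sup>2)] (q\<^sup>2))"
proof -
  define p where "p = q\<^sup>2"
  have p: "norm p < 1" "p \<noteq> 0"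
    using assms by (simp_all add: p_def norm_power power_less_one_iff)
  have ab: "a \<noteq> 0" "b \<noteq> 0" "norm a < 1" "norm b < 1"
    using assms by auto
  have eqs: "\<alpha> = - (a / b)" "z = a / q" "1 / \<alpha> = - (b / a)" "- (z / \<alpha>) = b / q" "c = - (a * b)"
    "- (c / a) = b" "- (c / b) = a"
    using assms(1-3) unfolding assms(7-9) by (auto simp: field_simps power2_eq_square)
  define Q where "Q y = qpoch_inf y p" for y
  have Qnz: "Q y \<noteq> 0" if "norm y < 1" for y
    unfolding Q_def by (intro qpoch_inf_nonzero mult_power_neq_1 p that)
  have Q_head: "Q y = (1 - y) * Q (y * p)" for y
    unfolding Q_def by (rule qpoch_inf_split_head[OF p(1)])
  define P where "P = p / (Q (b * q) * Q (a * q))"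
  have "norm (b * q) < 1" "norm (a * q) < 1"
    using ab assms(4) mult_strict_mono[of "norm b" 1 "norm q" 1] mult_strict_mono[of "norm a" 1 "norm q" 1]
    by (auto simp: norm_mult)
  hence "P \<noteq> 0" using p Qnz by (simp add: P_def)
  define W where "W = Q (- (a * b)) / (Q a * Q (- a) * (Q b * Q (- b)))"
  define D where "D = (1 + a) * (1 + b)"
  have "1 - (- a) \<noteq> 0" "1 - (- b) \<noteq> 0"
    using Qnz[of "- a"] Qnz[of "- b"] Q_head[of "- a"] Q_head[of "- b"] ab by auto
  hence D: "D \<noteq> 0" by (simp add: D_def)
  define \<theta> where "\<theta> x = (\<Sum>n. x ^ n * p ^ triangle n)" for x :: complex
  define r where "r = rho3 a b c p"
  define r' where "r' = rho3 b a c p"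
  have F1: "F \<alpha> z q = P * (1 / b * (W * \<theta> (- (a / b))) - r / D)"
    using F_eq_rho3[OF assms(1,4) ab] qpoch_inf_square[OF p(1)]
    unfolding eqs(1,2) P_def W_def D_def \<theta>_def r_def Q_def eqs(5) p_def by simp
  have F2: "F (1 / \<alpha>) (- (z / \<alpha>)) q = P * (1 / a * (W * \<theta> (- (b / a))) - r' / D)"
    using F_eq_rho3[OF assms(1,4) ab(2,1,4,3)] qpoch_inf_square[OF p(1)]
    unfolding eqs(3,4) P_def W_def D_def \<theta>_def r'_def Q_def eqs(5) p_def by (simp add: mult_ac)
  have "\<theta> (- (a / b)) / b - \<theta> (- (b / a)) / a = 1 / b * (\<theta> (- (a / b)) + 1 / (- (a / b)) * \<theta> (1 / (- (a / b))))"
    using ab by (simp add: field_simps)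
  also have "\<dots> = 1 / b * (Q p * Q (a * p / b) * Q (b / a))"
    using jacobi_triple_product[OF p, of "- (a / b)"] ab unfolding \<theta>_def Q_def by simp
  \<comment> \<open>The first factor of \<open>Q (b / a)\<close> is \<open>1 - b / a\<close>, and \<open>(1 - b / a) / b = 1 / b - 1 / a\<close>.\<close>
  also have "\<dots> = (1 / b - 1 / a) * (Q p * Q (a * p / b) * Q (b * p / a))"
    using ab by (subst Q_head[of "b / a"]) (simp add: field_simps)
  finally have theta: "\<theta> (- (a / b)) / b - \<theta> (- (b / a)) / a =
      (1 / b - 1 / a) * (Q p * Q (a * p / b) * Q (b * p / a))" .
  \<comment> \<open>The factors \<open>1 + a\<close> and \<open>1 + b\<close> remove the first factors of \<open>Q (- a)\<close> and \<open>Q (- b)\<close>.\<close>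
  have DW: "D * W = Q c / (Q b * (Q a * (Q (- (a * p)) * Q (- (b * p)))))"
    using Q_head[of "- a"] Q_head[of "- b"] D by (simp add: D_def W_def eqs(5) divide_simps)
  have "F \<alpha> z q = F (1 / \<alpha>) (- (z / \<alpha>)) q \<longleftrightarrow>
          1 / b * (W * \<theta> (- (a / b))) - r / D = 1 / a * (W * \<theta> (- (b / a))) - r' / D"
    unfolding F1 F2 using \<open>P \<noteq> 0\<close> by simp
  also have "\<dots> \<longleftrightarrow> r - r' = D * W * (\<theta> (- (a / b)) / b - \<theta> (- (b / a)) / a)"
    using D ab by (simp add: divide_simps) (auto simp: algebra_simps)
  also have "D * W * (\<theta> (- (a / b)) / b - \<theta> (- (b / a)) / a) =
      (1 / b - 1 / a) * (qpochs_inf [c, a * p / b, b * p / a, p] p /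
         qpochs_inf [- (c / a), - (c / b), - (a * p), - (b * p)] p)"
    unfolding theta DW eqs(6,7) by (simp add: qpochs_inf_def Q_def mult_ac)
  finally show ?thesis
    unfolding r_def r'_def p_def .
qed

end
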